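(* Let favors be substitutable, let $B^*$ be the cooperation bound, let $\Phi$ be a partition of the finite player set $N$ into communities, with $\phi(i)$ the community of $i$, and let $g$ be a community stable network. Then: (1) if $\phi(i)$ is a small community (i.e. $|\phi(i)|\le B^*$), then $d_i(g)\le B^*$; (2) if $d_i(g)>B^*$, then $\phi(i)$ is a large community (i.e. $|\phi(i)|>B^*$), and $ij\in g$ only if $j\in\phi(i)$.
   Context: Networks. $N=\{1,\dots,n\}$ is a finite set of players. A network $g$ is an undirected simple graph on $N$, viewed as its set of links; $N_i(g)=\{j: ij\in g\}$, $d_i(g)=|N_i(g)|$. Parameters: $\alpha\in(0,1]$, $p\in(0,1)$, $\delta\in(0,1)$, $v>c>0$, $\gamma\in[0,c)$. Favor exchange game (substitutable favors). Time is $t=0,1,2,\dots$; $g_t$ is the network at the beginning of period $t$, and $g_0=g$ is common knowledge. In each period: (i) players decide, for each of their links, to keep ($K$) or remove ($R$) it (a link removed by either side disappears permanently); (ii) at most one player requires a favor, each given player requiring one with probability $\alpha$; (iii) each other player is independently able to provide the favor in that period with probability $p$; (iv) if some current neighbors of the requester $i$ are able, one of them, $j$, is selected uniformly at random; (v) $j$ chooses $C$ (payoff $v$ to $i$, $-c$ to $j$) or $D$ (payoff $0$ to $i$, $-\gamma$ to $j$). All other payoffs are $0$; discount factor $\delta$. Player $i$ observes with whom she plays, the action profiles in periods in which she plays, and $N_i(g_t)$, but not $g_t$; in addition, information about interactions between members of a community is observed within that community. Community equilibrium. For players $i,j$ the community history $\tilde h_{t,ij}$ is: if $\phi(i)=\phi(j)$,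 the periods and action profiles of all previous interactions between $i$, $j$ and any $k\in\phi(i)$; if $\phi(i)\ne\phi(j)$, only the periods and action profiles of all past interactions between $i$ and $j$. A strategy $\sigma_i(h_{t,i},j)$ gives, for each private history $h_{t,i}$ of $i$ and each $j\ne i$, a distribution over $i$'s decisions toward $j$. A profile $\sigma$ is measurable with respect to community histories if $\sigma_i(h_{t,i},j)=\sigma_i(h'_{t,i},j)$ whenever $\tilde h_{t,ij}=\tilde h'_{t,ij}$, for all $i,j$. $(g,\sigma)$ is a community equilibrium if $\sigma$ is measurable with respect to community histories and is part of a sequential equilibrium of the game with $g_0=g$. $g$ is community stable if there is a community equilibrium $(g,\sigma)$ in which on the equilibrium path all favors are provided and all links are kept. Cooperation bound. $B^*$ is the non-negative integer such that $\delta\alpha v(1-p)^{m-1}p-\delta\alpha c\frac{1-(1-p)^m}{m}\ge(1-\delta)(c-\gamma)$ holds for all positive integers $m\le B^*$ and fails for all $m>B^*$. *)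

theory Defs
  imports "HOL-Probability.Probability"
begin

section \<open>Networks and communities\<close>

text \<open>The player set is the finite type \<open>'p\<close>. The link between \<open>i\<close> and \<open>j\<close> is the two-element
  set \<open>{i, j}\<close>.\<close>

type_synonym 'p network = "'p set set"

definition network :: "'p network \<Rightarrow> bool" where
  "network g \<longleftrightarrow> (\<forall>e\<in>g. card e = 2)"

definition nbrs :: "'p network \<Rightarrow> 'p \<Rightarrow> 'p set" where
  "nbrs g i = {j. {i, j} \<in> g}"

definition deg :: "'p network \<Rightarrow> 'p \<Rightarrow> nat" where
  "deg g i = card (nbrs g i)"

definition community :: "'p set set \<Rightarrow> 'p \<Rightarrow> 'p set" where
  "community \<Phi> i = (THE C. C \<in> \<Phi> \<and> i \<in> C)"


section \<open>Parameters and the cooperation bound\<close>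

record favor_params =
  req_prob :: real      \<comment> \<open>\<open>\<alpha>\<close>: a given player requires a favor in a given period\<close>
  able_prob :: real     \<comment> \<open>\<open>p\<close>: a given other player is able to provide it\<close>
  discount :: real      \<comment> \<open>\<open>\<delta>\<close>\<close>
  benefit :: real       \<comment> \<open>\<open>v\<close>\<close>
  cost :: real          \<comment> \<open>\<open>c\<close>\<close>
  refusal_cost :: real  \<comment> \<open>\<open>\<gamma>\<close>\<close>

definition cooperation_ineq :: "favor_params \<Rightarrow> nat \<Rightarrow> bool" where
  "cooperation_ineq G m \<longleftrightarrow>
     discount G * req_prob G * benefit G * (1 - able_prob G) ^ (m - 1) * able_prob G
       - discount G * req_prob G * cost G * ((1 - (1 - able_prob G) ^ m) / real m)
     \<ge> (1 - discount G) * (cost G - refusal_cost G)"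

definition cooperation_bound :: "favor_params \<Rightarrow> nat \<Rightarrow> bool" where
  "cooperation_bound G B \<longleftrightarrow>
     (\<forall>m. 1 \<le> m \<and> m \<le> B \<longrightarrow> cooperation_ineq G m) \<and> (\<forall>m>B. \<not> cooperation_ineq G m)"


section \<open>Histories and what players observe\<close>

datatype link_act = Keep | Remove
datatype favor_act = Coop | Defect

text \<open>In a link profile \<open>L\<close>, the value \<open>L (i, j)\<close> is the decision of \<open>i\<close> on her link with \<open>j\<close>; on
  pairs that are not currently linked it is \<open>Keep\<close> by convention. An interaction \<open>(r, s, a)\<close> means
  that \<open>r\<close> required a favor, \<open>s\<close> was selected to provide it, and \<open>s\<close> chose \<open>a\<close>. A history lists the
  past periods, oldest first; a period without interaction (no favor required, or no current
  neighbor able) has \<open>None\<close> as its second component.\<close>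

type_synonym 'p links = "'p \<times> 'p \<Rightarrow> link_act"
type_synonym 'p interaction = "'p \<times> 'p \<times> favor_act"
type_synonym 'p history = "('p links \<times> 'p interaction option) list"

definition prune :: "'p network \<Rightarrow> 'p links \<Rightarrow> 'p network" where
  "prune g L = {e \<in> g. \<forall>i j. e = {i, j} \<longrightarrow> L (i, j) = Keep}"

definition net :: "'p network \<Rightarrow> 'p history \<Rightarrow> 'p network" where
  "net g h = fold (\<lambda>x g'. prune g' (fst x)) h g"

definition restrict_opt :: "('b \<Rightarrow> bool) \<Rightarrow> 'b option \<Rightarrow> 'b option" where
  "restrict_opt P z = (case z of None \<Rightarrow> None | Some y \<Rightarrow> if P y then Some y else None)"

definition sees :: "'p set set \<Rightarrow> 'p \<Rightarrow> 'p interaction \<Rightarrow> bool" where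
  "sees \<Phi> i = (\<lambda>(r, s, a). i = r \<or> i = s \<or> {r, s} \<subseteq> community \<Phi> i)"

text \<open>A private history at the beginning of period \<open>t\<close>: for each earlier period, the neighborhood at
  its beginning, the own link decisions, and the interaction if it is observed; then the
  current neighborhood.\<close>

type_synonym 'p priv =
  "('p set \<times> ('p \<Rightarrow> link_act) \<times> 'p interaction option) list \<times> 'p set"

definition priv :: "'p set set \<Rightarrow> 'p network \<Rightarrow> 'p \<Rightarrow> 'p history \<Rightarrow> 'p priv" where
  "priv \<Phi> g i h =
     (map (\<lambda>t. (nbrs (net g (take t h)) i,
                 (\<lambda>j. fst (h ! t) (i, j)),
                 restrict_opt (sees \<Phi> i) (snd (h ! t)))) [0..<length h],
      nbrs (net g h) i)"

text \<open>The community history of the pair \<open>i\<close>, \<open>j\<close>. Everything it contains is observed by \<open>i\<close>; list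
  positions are the periods, so equal community histories have the same length.\<close>

definition pair_relevant :: "'p set set \<Rightarrow> 'p \<Rightarrow> 'p \<Rightarrow> 'p interaction \<Rightarrow> bool" where
  "pair_relevant \<Phi> i j = (\<lambda>(r, s, a).
     if community \<Phi> i = community \<Phi> j
     then (\<exists>k \<in> community \<Phi> i. {r, s} \<subseteq> {i, j, k})
     else {r, s} = {i, j})"

definition comm_hist ::
  "'p set set \<Rightarrow> 'p \<Rightarrow> 'p \<Rightarrow> 'p history \<Rightarrow> 'p interaction option list" where
  "comm_hist \<Phi> i j h = map (\<lambda>x. restrict_opt (pair_relevant \<Phi> i j) (snd x)) h"


section \<open>Strategies and the course of play\<close>

text \<open>A strategy randomizes separately towards each other player. \<open>link_choice q j\<close> is the keep/remove
  decision about \<open>j\<close> at private history \<open>q\<close>; \<open>favor_choice q l j\<close> is the decision when selected to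
  provide a favor to \<open>j\<close> later in the same period, where \<open>l\<close> are the own link decisions already
  taken in this period.\<close>

record 'p strategy =
  link_choice :: "'p priv \<Rightarrow> 'p \<Rightarrow> link_act pmf"
  favor_choice :: "'p priv \<Rightarrow> ('p \<Rightarrow> link_act) \<Rightarrow> 'p \<Rightarrow> favor_act pmf"

type_synonym 'p profile = "'p \<Rightarrow> 'p strategy"

definition links_pmf ::
  "'p::finite set set \<Rightarrow> 'p network \<Rightarrow> 'p profile \<Rightarrow> 'p history \<Rightarrow> 'p links pmf" where
  "links_pmf \<Phi> g \<sigma> h =
     Pi_pmf {(i, j). j \<in> nbrs (net g h) i} Keep
       (\<lambda>(i, j). link_choice (\<sigma> i) (priv \<Phi> g i h) j)"

definition requester_pmf :: "favor_params \<Rightarrow> 'p::finite option pmf" where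
  "requester_pmf G =
     embed_pmf (\<lambda>z. case z of None \<Rightarrow> 1 - real CARD('p) * req_prob G | Some _ \<Rightarrow> req_prob G)"

definition able_pmf :: "favor_params \<Rightarrow> 'p::finite \<Rightarrow> 'p set pmf" where
  "able_pmf G r =
     map_pmf (\<lambda>b. {k. b k}) (Pi_pmf (UNIV - {r}) False (\<lambda>_. bernoulli_pmf (able_prob G)))"

text \<open>The requester and the selected provider, in a period whose network after the link decisions
  is \<open>g'\<close>. The set of able players is payoff-irrelevant and unobserved beyond this selection, so it
  is not recorded in histories.\<close>

definition meeting_pmf :: "favor_params \<Rightarrow> 'p::finite network \<Rightarrow> ('p \<times> 'p) option pmf" where
  "meeting_pmf G g' =
     bind_pmf (requester_pmf G) (\<lambda>z. case z of
       None \<Rightarrow> return_pmf None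
     | Some r \<Rightarrow> bind_pmf (able_pmf G r) (\<lambda>A.
         if A \<inter> nbrs g' r = {} then return_pmf None
         else map_pmf (\<lambda>s. Some (r, s)) (pmf_of_set (A \<inter> nbrs g' r))))"

definition favor_pmf ::
  "'p set set \<Rightarrow> 'p network \<Rightarrow> 'p profile \<Rightarrow> 'p history \<Rightarrow> 'p links \<Rightarrow> 'p \<Rightarrow> 'p \<Rightarrow> favor_act pmf" where
  "favor_pmf \<Phi> g \<sigma> h L r s = favor_choice (\<sigma> s) (priv \<Phi> g s h) (\<lambda>j. L (s, j)) r"

definition period_pmf ::
  "favor_params \<Rightarrow> 'p::finite set set \<Rightarrow> 'p network \<Rightarrow> 'p profile \<Rightarrow> 'p history
     \<Rightarrow> ('p links \<times> 'p interaction option) pmf" where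
  "period_pmf G \<Phi> g \<sigma> h =
     bind_pmf (links_pmf \<Phi> g \<sigma> h) (\<lambda>L.
     bind_pmf (meeting_pmf G (prune (net g h) L)) (\<lambda>z. case z of
       None \<Rightarrow> return_pmf (L, None)
     | Some (r, s) \<Rightarrow> map_pmf (\<lambda>a. (L, Some (r, s, a))) (favor_pmf \<Phi> g \<sigma> h L r s)))"

text \<open>\<open>play G \<Phi> g \<sigma> h k\<close> is the distribution of the history \<open>k\<close> periods after \<open>h\<close>.\<close>

primrec play ::
  "favor_params \<Rightarrow> 'p::finite set set \<Rightarrow> 'p network \<Rightarrow> 'p profile \<Rightarrow> 'p history \<Rightarrow> nat
     \<Rightarrow> 'p history pmf" where
  "play G \<Phi> g \<sigma> h 0 = return_pmf h"
| "play G \<Phi> g \<sigma> h (Suc k) =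
     bind_pmf (play G \<Phi> g \<sigma> h k) (\<lambda>h'. map_pmf (\<lambda>x. h' @ [x]) (period_pmf G \<Phi> g \<sigma> h'))"

definition payoff :: "favor_params \<Rightarrow> 'p \<Rightarrow> 'p interaction option \<Rightarrow> real" where
  "payoff G i z = (case z of
     None \<Rightarrow> 0
   | Some (r, s, Coop) \<Rightarrow> if i = r then benefit G else if i = s then - cost G else 0
   | Some (r, s, Defect) \<Rightarrow> if i = s then - refusal_cost G else 0)"

definition cont_value ::
  "favor_params \<Rightarrow> 'p::finite set set \<Rightarrow> 'p network \<Rightarrow> 'p profile \<Rightarrow> 'p \<Rightarrow> 'p history \<Rightarrow> real" where
  "cont_value G \<Phi> g \<sigma> i h =
     (\<Sum>k. discount G ^ k *
        measure_pmf.expectation (play G \<Phi> g \<sigma> h (Suc k)) (\<lambda>h'. payoff G i (snd (last h'))))"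


section \<open>Sequential equilibrium\<close>

text \<open>\<open>Link_node h\<close> is the link stage after \<open>h\<close>, where all players move simultaneously;
  \<open>Favor_node h L r s\<close> is the later stage of the same period at which, after link decisions \<open>L\<close>,
  player \<open>s\<close> has been selected to provide a favor to \<open>r\<close>.\<close>

datatype 'p node = Link_node "'p history" | Favor_node "'p history" "'p links" 'p 'p

datatype 'p info = At_links "'p priv" | At_favor "'p priv" "'p \<Rightarrow> link_act" 'p

fun moves :: "'p \<Rightarrow> 'p node \<Rightarrow> bool" where
  "moves i (Link_node h) = True"
| "moves i (Favor_node h L r s) = (i = s)"

fun info_at :: "'p set set \<Rightarrow> 'p network \<Rightarrow> 'p \<Rightarrow> 'p node \<Rightarrow> 'p info" where
  "info_at \<Phi> g i (Link_node h) = At_links (priv \<Phi> g i h)"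
| "info_at \<Phi> g i (Favor_node h L r s) = At_favor (priv \<Phi> g i h) (\<lambda>j. L (i, j)) r"

fun node_prob ::
  "favor_params \<Rightarrow> 'p::finite set set \<Rightarrow> 'p network \<Rightarrow> 'p profile \<Rightarrow> 'p node \<Rightarrow> real" where
  "node_prob G \<Phi> g \<sigma> (Link_node h) = pmf (play G \<Phi> g \<sigma> [] (length h)) h"
| "node_prob G \<Phi> g \<sigma> (Favor_node h L r s) =
     pmf (play G \<Phi> g \<sigma> [] (length h)) h * pmf (links_pmf \<Phi> g \<sigma> h) L
       * pmf (meeting_pmf G (prune (net g h) L)) (Some (r, s))"

text \<open>The nodes of the game tree are those that some profile reaches with positive probability.\<close>

definition nodes :: "favor_params \<Rightarrow> 'p::finite set set \<Rightarrow> 'p network \<Rightarrow> 'p node set" where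
  "nodes G \<Phi> g = {x. \<exists>\<sigma>. node_prob G \<Phi> g \<sigma> x > 0}"

definition info_set ::
  "favor_params \<Rightarrow> 'p::finite set set \<Rightarrow> 'p network \<Rightarrow> 'p \<Rightarrow> 'p info \<Rightarrow> 'p node set" where
  "info_set G \<Phi> g i I = {x \<in> nodes G \<Phi> g. moves i x \<and> info_at \<Phi> g i x = I}"

fun node_value ::
  "favor_params \<Rightarrow> 'p::finite set set \<Rightarrow> 'p network \<Rightarrow> 'p profile \<Rightarrow> 'p \<Rightarrow> 'p node \<Rightarrow> real" where
  "node_value G \<Phi> g \<sigma> i (Link_node h) = cont_value G \<Phi> g \<sigma> i h"
| "node_value G \<Phi> g \<sigma> i (Favor_node h L r s) =
     measure_pmf.expectation (favor_pmf \<Phi> g \<sigma> h L r s)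
       (\<lambda>a. payoff G i (Some (r, s, a))
             + discount G * cont_value G \<Phi> g \<sigma> i (h @ [(L, Some (r, s, a))]))"

type_synonym 'p beliefs = "'p \<Rightarrow> 'p info \<Rightarrow> 'p node pmf"

definition sequentially_rational ::
  "favor_params \<Rightarrow> 'p::finite set set \<Rightarrow> 'p network \<Rightarrow> 'p profile \<Rightarrow> 'p beliefs \<Rightarrow> bool" where
  "sequentially_rational G \<Phi> g \<sigma> \<mu> \<longleftrightarrow>
     (\<forall>i I \<tau>. info_set G \<Phi> g i I \<noteq> {} \<longrightarrow>
        measure_pmf.expectation (\<mu> i I) (node_value G \<Phi> g (\<sigma>(i := \<tau>)) i)
          \<le> measure_pmf.expectation (\<mu> i I) (node_value G \<Phi> g \<sigma> i))"

definition completely_mixed :: "'p profile \<Rightarrow> bool" where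
  "completely_mixed \<sigma> \<longleftrightarrow>
     (\<forall>i q l j. set_pmf (link_choice (\<sigma> i) q j) = UNIV \<and>
                set_pmf (favor_choice (\<sigma> i) q l j) = UNIV)"

definition profile_tendsto :: "(nat \<Rightarrow> 'p profile) \<Rightarrow> 'p profile \<Rightarrow> bool" where
  "profile_tendsto \<Sigma> \<sigma> \<longleftrightarrow>
     (\<forall>i q j a. (\<lambda>n. pmf (link_choice (\<Sigma> n i) q j) a)
                   \<longlonglongrightarrow> pmf (link_choice (\<sigma> i) q j) a) \<and>
     (\<forall>i q l j a. (\<lambda>n. pmf (favor_choice (\<Sigma> n i) q l j) a)
                   \<longlonglongrightarrow> pmf (favor_choice (\<sigma> i) q l j) a)"

lemma finite_link_act: "finite (UNIV :: link_act set)"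
  by (rule finite_subset[of _ "{Keep, Remove}"]) (auto intro: link_act.exhaust)

lemma finite_favor_act: "finite (UNIV :: favor_act set)"
  by (rule finite_subset[of _ "{Coop, Defect}"]) (auto intro: favor_act.exhaust)

lemma finite_links: "finite (UNIV :: 'p::finite links set)"
proof -
  have "finite (Pi\<^sub>E (UNIV :: ('p \<times> 'p) set) (\<lambda>_. UNIV :: link_act set))"
    by (rule finite_PiE) (simp_all add: finite_link_act)
  then show ?thesis by (simp add: PiE_UNIV_domain)
qed

lemma finite_histories: "finite {h :: 'p::finite history. length h = t}"
proof -
  have "finite (UNIV :: 'p interaction set)"
    using finite_Prod_UNIV[OF finite finite_Prod_UNIV[OF finite finite_favor_act]] .
  then have "finite (UNIV :: 'p interaction option set)"
    by (simp add: finite_option_UNIV)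
  then have "finite (UNIV :: ('p links \<times> 'p interaction option) set)"
    by (rule finite_Prod_UNIV[OF finite_links])
  from finite_lists_length_eq[OF this, of t] show ?thesis by simp
qed

lemma finite_info_set: "finite (info_set G \<Phi> g i I)"
proof -
  define q where "q = (case I of At_links q \<Rightarrow> q | At_favor q l r \<Rightarrow> q)"
  define H where "H = {h :: 'a history. length h = length (fst q)}"
  have "finite H" unfolding H_def by (rule finite_histories)
  have "info_set G \<Phi> g i I
      \<subseteq> Link_node ` H \<union> (\<lambda>(h, L, r, s). Favor_node h L r s) ` (H \<times> UNIV)"
  proof
    fix x assume "x \<in> info_set G \<Phi> g i I"
    then have "info_at \<Phi> g i x = I" by (simp add: info_set_def)
    then show "x \<in> Link_node ` H \<union> (\<lambda>(h, L, r, s). Favor_node h L r s) ` (H \<times> UNIV)"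
      by (cases x) (auto simp: q_def H_def priv_def image_iff)
  qed
  moreover have "finite (UNIV :: ('a links \<times> 'a \<times> 'a) set)"
    by (rule finite_Prod_UNIV[OF finite_links]) simp
  ultimately show ?thesis
    using \<open>finite H\<close> by (auto intro: finite_subset)
qed

text \<open>Kreps--Wilson consistency. By the previous lemma the sum is the probability of reaching the
  information set; it is positive under completely mixed profiles.\<close>

definition bayes ::
  "favor_params \<Rightarrow> 'p::finite set set \<Rightarrow> 'p network \<Rightarrow> 'p profile \<Rightarrow> 'p \<Rightarrow> 'p info \<Rightarrow> 'p node \<Rightarrow> real" where
  "bayes G \<Phi> g \<sigma> i I x =
     node_prob G \<Phi> g \<sigma> x / (\<Sum>y\<in>info_set G \<Phi> g i I. node_prob G \<Phi> g \<sigma> y)"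

definition consistent ::
  "favor_params \<Rightarrow> 'p::finite set set \<Rightarrow> 'p network \<Rightarrow> 'p profile \<Rightarrow> 'p beliefs \<Rightarrow> bool" where
  "consistent G \<Phi> g \<sigma> \<mu> \<longleftrightarrow>
     (\<exists>\<Sigma>. (\<forall>n. completely_mixed (\<Sigma> n)) \<and> profile_tendsto \<Sigma> \<sigma> \<and>
        (\<forall>i I. \<forall>x\<in>info_set G \<Phi> g i I.
            (\<lambda>n. bayes G \<Phi> g (\<Sigma> n) i I x) \<longlonglongrightarrow> pmf (\<mu> i I) x))"

definition sequential_equilibrium ::
  "favor_params \<Rightarrow> 'p::finite set set \<Rightarrow> 'p network \<Rightarrow> 'p profile \<Rightarrow> 'p beliefs \<Rightarrow> bool" where
  "sequential_equilibrium G \<Phi> g \<sigma> \<mu> \<longleftrightarrow>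
     sequentially_rational G \<Phi> g \<sigma> \<mu> \<and> consistent G \<Phi> g \<sigma> \<mu>"


section \<open>Community equilibrium and community stability\<close>

definition community_measurable ::
  "favor_params \<Rightarrow> 'p::finite set set \<Rightarrow> 'p network \<Rightarrow> 'p profile \<Rightarrow> bool" where
  "community_measurable G \<Phi> g \<sigma> \<longleftrightarrow>
     (\<forall>i j h h'. i \<noteq> j \<and> comm_hist \<Phi> i j h = comm_hist \<Phi> i j h' \<longrightarrow>
        (Link_node h \<in> nodes G \<Phi> g \<and> Link_node h' \<in> nodes G \<Phi> g \<longrightarrow>
           link_choice (\<sigma> i) (priv \<Phi> g i h) j = link_choice (\<sigma> i) (priv \<Phi> g i h') j) \<and>
        (\<forall>L L'. Favor_node h L j i \<in> nodes G \<Phi> g \<and> Favor_node h' L' j i \<in> nodes G \<Phi> g \<longrightarrow>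
           favor_pmf \<Phi> g \<sigma> h L j i = favor_pmf \<Phi> g \<sigma> h' L' j i))"

definition community_equilibrium ::
  "favor_params \<Rightarrow> 'p::finite set set \<Rightarrow> 'p network \<Rightarrow> 'p profile \<Rightarrow> bool" where
  "community_equilibrium G \<Phi> g \<sigma> \<longleftrightarrow>
     community_measurable G \<Phi> g \<sigma> \<and> (\<exists>\<mu>. sequential_equilibrium G \<Phi> g \<sigma> \<mu>)"

definition cooperative_path ::
  "favor_params \<Rightarrow> 'p::finite set set \<Rightarrow> 'p network \<Rightarrow> 'p profile \<Rightarrow> bool" where
  "cooperative_path G \<Phi> g \<sigma> \<longleftrightarrow>
     (\<forall>t. \<forall>h\<in>set_pmf (play G \<Phi> g \<sigma> [] t). \<forall>(L, z)\<in>set h.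
        (\<forall>i j. L (i, j) = Keep) \<and> (\<forall>r s a. z = Some (r, s, a) \<longrightarrow> a = Coop))"

definition community_stable ::
  "favor_params \<Rightarrow> 'p::finite set set \<Rightarrow> 'p network \<Rightarrow> bool" where
  "community_stable G \<Phi> g \<longleftrightarrow>
     (\<exists>\<sigma>. community_equilibrium G \<Phi> g \<sigma> \<and> cooperative_path G \<Phi> g \<sigma>)"

end

theory Submission
  imports Defs
begin

text \<open>Suppose \<open>i\<close> and \<open>j\<close> are linked across communities, with \<open>j\<close> of degree at most that of \<open>i\<close>, and
  that in the first period \<open>i\<close> is asked for a favor by \<open>j\<close>. Player \<open>i\<close> can refuse, drop the link in
  the next period, and keep cooperating with everybody else. No community history of a pair other
  than \<open>{i, j}\<close> records the refusal, so by measurability all other relationships continue exactly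
  as on the equilibrium path, and the deviation costs only the discounted value of the link. That
  value is \<open>\<alpha> (v (1 - p)\<^sup>d\<^sup>-\<^sup>1 p - c q(d\<^sub>j)) / (1 - \<delta>)\<close> with \<open>d = deg g i\<close>, \<open>d\<^sub>j = deg g j\<close> and
  \<open>q(m) = (1 - (1 - p)\<^sup>m) / m\<close>. Since \<open>q\<close> is decreasing and \<open>d\<^sub>j \<le> d\<close>, sequential rationality gives
  the cooperation inequality at \<open>d\<close>, hence \<open>d \<le> B\<close>. Exchanging \<open>i\<close> and \<open>j\<close>, a link across
  communities forces both degrees to be at most \<open>B\<close>.\<close>

section \<open>Selection of providers and the value of a link\<close>

text \<open>The probability, given a request by a player with \<open>m\<close> neighbors, that one
  fixed neighbor is selected: some neighbor is able with probability \<open>1 - (1 - p) ^ m\<close>,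
  and by symmetry the \<open>m\<close> neighbors share it equally.\<close>

definition selection_prob :: "favor_params \<Rightarrow> nat \<Rightarrow> real" where
  "selection_prob G m = (1 - (1 - able_prob G) ^ m) / real m"

text \<open>With \<open>x = 1 - p\<close>, \<open>selection_prob G m\<close> is \<open>p\<close>
  times the average of \<open>x ^ k\<close> over \<open>k < m\<close>. The next power
  \<open>x ^ m\<close> lies below this average, so including it cannot raise the average.\<close>

lemma selection_prob_Suc_le:
  assumes "0 < able_prob G" "able_prob G < 1" "1 \<le> m"
  shows "selection_prob G (Suc m) \<le> selection_prob G m"
proof -
  define x where "x = 1 - able_prob G"
  have x: "0 < x" "x < 1" using assms by (auto simp: x_def)
  have "(\<Sum>k<m. x ^ m) \<le> (\<Sum>k<m. x ^ k)"
    using x by (intro sum_mono power_decreasing) auto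
  then have "real m * x ^ m * (1 - x) \<le> (1 - x) * (\<Sum>k<m. x ^ k)"
    using x by simp
  also have "\<dots> = 1 - x ^ m"
    by (simp add: one_diff_power_eq)
  finally have "real m * (1 - x ^ Suc m) \<le> real (Suc m) * (1 - x ^ m)"
    by (simp add: algebra_simps)
  then show ?thesis
    using assms(3) by (simp add: selection_prob_def x_def[symmetric] field_simps)
qed

lemma selection_prob_antimono:
  assumes "0 < able_prob G" "able_prob G < 1" "1 \<le> m" "m \<le> n"
  shows "selection_prob G n \<le> selection_prob G m"
  using assms(4)
proof (induction n rule: dec_induct)
  case (step n)
  then show ?case
    using selection_prob_Suc_le[OF assms(1,2), of n] assms(3) by simp
qed simp

section \<open>Neighborhoods and the law of the requester and the selected provider\<close>

lemma nbrs_irrefl: "network g \<Longrightarrow> i \<notin> nbrs g i"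
  by (auto simp: network_def nbrs_def)

lemma link_distinct: "network g \<Longrightarrow> {a, b} \<in> g \<Longrightarrow> a \<noteq> b"
  using nbrs_irrefl[of g a] by (auto simp: nbrs_def)

lemma nbrs_sym: "s \<in> nbrs g r \<longleftrightarrow> r \<in> nbrs g s"
  by (auto simp: nbrs_def insert_commute)

lemma pmf_requester:
  assumes "0 \<le> req_prob G" "real CARD('p::finite) * req_prob G \<le> 1"
  shows "pmf (requester_pmf G) (z :: 'p option) =
    (case z of None \<Rightarrow> 1 - real CARD('p) * req_prob G | Some _ \<Rightarrow> req_prob G)"
proof -
  let ?f = "\<lambda>z :: 'p option. case z of None \<Rightarrow> 1 - real CARD('p) * req_prob G | Some _ \<Rightarrow> req_prob G"
  have nonneg: "0 \<le> ?f z" for z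
    using assms by (cases z) auto
  have "(\<integral>\<^sup>+z. ennreal (?f z) \<partial>count_space UNIV) = ennreal (\<Sum>z\<in>UNIV. ?f z)"
    using nonneg by (simp add: nn_integral_count_space_finite sum_ennreal)
  also have "(\<Sum>z\<in>UNIV. ?f z) = 1"
    by (simp add: UNIV_option_conv sum.reindex)
  finally show ?thesis
    unfolding requester_pmf_def by (subst pmf_embed_pmf) (use nonneg in auto)
qed

text \<open>The \<open>Some\<close> branch of \<open>meeting_pmf\<close>, split off so that
  selection can be computed for a fixed requester.\<close>

definition select_pmf :: "favor_params \<Rightarrow> 'p::finite network \<Rightarrow> 'p \<Rightarrow> ('p \<times> 'p) option pmf" where
  "select_pmf G g r = bind_pmf (able_pmf G r) (\<lambda>A.
         if A \<inter> nbrs g r = {} then return_pmf None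
         else map_pmf (\<lambda>s. Some (r, s)) (pmf_of_set (A \<inter> nbrs g r)))"

lemma meeting_pmf_select:
  "meeting_pmf G g = bind_pmf (requester_pmf G)
     (\<lambda>z. case z of None \<Rightarrow> return_pmf None | Some r \<Rightarrow> select_pmf G g r)"
  unfolding meeting_pmf_def select_pmf_def ..

lemma pmf_select:
  fixes r :: "'p::finite"
  shows "pmf (select_pmf G g r) (Some (r', s)) =
    (\<Sum>A\<in>UNIV. (if r' = r \<and> s \<in> A \<inter> nbrs g r then 1 / real (card (A \<inter> nbrs g r)) else 0)
       * pmf (able_pmf G r) A)"
proof -
  have "pmf (if A \<inter> nbrs g r = {} then return_pmf None
      else map_pmf (\<lambda>s. Some (r, s)) (pmf_of_set (A \<inter> nbrs g r))) (Some (r', s)) =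
    (if r' = r \<and> s \<in> A \<inter> nbrs g r then 1 / real (card (A \<inter> nbrs g r)) else 0)" for A
  proof (cases "r' = r \<and> A \<inter> nbrs g r \<noteq> {}")
    case True
    have "pmf (map_pmf (\<lambda>s. Some (r, s)) (pmf_of_set (A \<inter> nbrs g r))) (Some (r, s))
        = pmf (pmf_of_set (A \<inter> nbrs g r)) s"
      by (rule pmf_map_inj') (simp add: inj_def)
    with True show ?thesis by (auto simp: indicator_def)
  next
    case False
    then show ?thesis by (auto simp: pmf_eq_0_set_pmf)
  qed
  then show ?thesis
    unfolding select_pmf_def pmf_bind
    by (simp only:) (rule integral_measure_pmf_real, simp_all)
qed

text \<open>Abilities are independent and identically distributed over the players other than
  \<open>r\<close>, so exchanging two of them preserves the law. This symmetry makes all neighbors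
  of \<open>r\<close> equally likely to be selected.\<close>

lemma able_pmf_transpose:
  fixes r :: "'p::finite"
  assumes "s \<noteq> r" "s' \<noteq> r"
  shows "map_pmf ((`) (Transposition.transpose s s')) (able_pmf G r) = able_pmf G r"
proof -
  have "bij_betw (Transposition.transpose s s') (UNIV - {r}) (UNIV - {r})"
    using assms by simp
  then have "able_pmf G r = map_pmf (\<lambda>b. {k. (b \<circ> Transposition.transpose s s') k})
      (Pi_pmf (UNIV - {r}) False (\<lambda>_. bernoulli_pmf (able_prob G)))"
    unfolding able_pmf_def
    by (subst Pi_pmf_bij_betw[where h = "Transposition.transpose s s'" and B = "UNIV - {r}"])
       (use assms in \<open>auto simp: map_pmf_comp Transposition.transpose_def[of _ _ r]\<close>)
  also have "(\<lambda>b. {k. (b \<circ> Transposition.transpose s s') k}) = (\<lambda>b. Transposition.transpose s s' ` {k. b k})"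
    by (auto simp: fun_eq_iff image_iff) (metis Transposition.transpose_involutory)
  finally show ?thesis
    unfolding able_pmf_def map_pmf_comp by (rule sym)
qed

lemma prob_no_neighbor_able:
  fixes g :: "'p::finite network"
  assumes "network g" "0 < able_prob G" "able_prob G < 1"
  shows "measure_pmf.prob (able_pmf G r) {A. A \<inter> nbrs g r = {}} = (1 - able_prob G) ^ deg g r"
proof -
  let ?P = "Pi_pmf (UNIV - {r}) False (\<lambda>_. bernoulli_pmf (able_prob G))"
  let ?B = "\<lambda>k. if k \<in> nbrs g r then {False} else UNIV"
  have "measure_pmf.prob (able_pmf G r) {A. A \<inter> nbrs g r = {}}
      = measure_pmf.prob ?P {b. \<forall>k\<in>nbrs g r. \<not> b k}"
    unfolding able_pmf_def measure_map_pmf by (rule arg_cong[where f = "measure_pmf.prob _"]) auto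
  \<comment> \<open>The event is a product set: \<open>False\<close> is forced on neighbors and all
    else is free. Irreflexivity ensures that all its constraints lie in the index set
    \<open>UNIV - {r}\<close>.\<close>
  also have "{b. \<forall>k\<in>nbrs g r. \<not> b k} = Pi (UNIV - {r}) ?B"
    using nbrs_irrefl[OF assms(1), of r] by (fastforce simp: Pi_def split: if_splits)
  also have "measure_pmf.prob ?P \<dots> =
      (\<Prod>k\<in>UNIV - {r}. measure_pmf.prob (bernoulli_pmf (able_prob G)) (?B k))"
    by (rule measure_Pi_pmf_Pi) simp
  also have "\<dots> = (\<Prod>k\<in>UNIV - {r}. if k \<in> nbrs g r then 1 - able_prob G else 1)"
    using assms by (intro prod.cong) (auto simp: measure_pmf_single)
  also have "\<dots> = (\<Prod>k\<in>nbrs g r. 1 - able_prob G)"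
    using nbrs_irrefl[OF assms(1), of r] by (intro prod.mono_neutral_cong_right) auto
  finally show ?thesis by (simp add: deg_def)
qed

text \<open>Exchanging two neighbors shows that all have the same selection probability. These
  probabilities add up to the probability that some neighbor is able; dividing by the degree gives
  the value.\<close>

lemma pmf_select_eq:
  fixes g :: "'p::finite network"
  assumes "network g" "0 < able_prob G" "able_prob G < 1" "s \<in> nbrs g r"
  shows "pmf (select_pmf G g r) (Some (r, s)) = selection_prob G (deg g r)"
proof -
  let ?N = "nbrs g r"
  let ?w = "\<lambda>s A. if s \<in> A \<inter> ?N then 1 / real (card (A \<inter> ?N)) else 0"
  have w: "pmf (select_pmf G g r) (Some (r, s)) = measure_pmf.expectation (able_pmf G r) (?w s)" for s
    unfolding pmf_select by (subst integral_measure_pmf_real[of UNIV]) auto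
  have eq: "pmf (select_pmf G g r) (Some (r, s')) = pmf (select_pmf G g r) (Some (r, s))"
    if s': "s' \<in> ?N" for s'
  proof -
    have ne: "s \<noteq> r" "s' \<noteq> r" using nbrs_irrefl[OF assms(1), of r] assms(4) s' by auto
    have "measure_pmf.expectation (able_pmf G r) (?w s') =
        measure_pmf.expectation (map_pmf ((`) (Transposition.transpose s s')) (able_pmf G r)) (?w s')"
      by (simp add: able_pmf_transpose[OF ne])
    also have "\<dots> = measure_pmf.expectation (able_pmf G r) (\<lambda>A. ?w s' (Transposition.transpose s s' ` A))"
      by simp
    also have "(\<lambda>A. ?w s' (Transposition.transpose s s' ` A)) = ?w s"
    proof
      fix A
      have N: "Transposition.transpose s s' ` ?N = ?N"
        using s' assms(4) by (auto simp: Transposition.transpose_def image_iff)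
      have "Transposition.transpose s s' ` A \<inter> ?N = Transposition.transpose s s' ` (A \<inter> ?N)"
        by (subst N[symmetric]) (simp add: image_Int)
      moreover have "card (Transposition.transpose s s' ` (A \<inter> ?N)) = card (A \<inter> ?N)"
        by (rule card_image) simp
      moreover have "s' \<in> Transposition.transpose s s' ` (A \<inter> ?N) \<longleftrightarrow> s \<in> A \<inter> ?N"
        by (auto simp: image_iff Transposition.transpose_eq_iff Transposition.transpose_def
            split: if_splits)
      ultimately show "?w s' (Transposition.transpose s s' ` A) = ?w s A" by (simp only:)
    qed
    finally show ?thesis by (simp only: w)
  qed
  have "real (deg g r) * pmf (select_pmf G g r) (Some (r, s))
      = (\<Sum>s'\<in>?N. pmf (select_pmf G g r) (Some (r, s')))"
    by (simp add: eq deg_def)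
  also have "\<dots> = (\<Sum>s'\<in>?N. \<Sum>A\<in>UNIV. ?w s' A * pmf (able_pmf G r) A)"
    unfolding pmf_select by simp
  also have "\<dots> = (\<Sum>A\<in>UNIV. \<Sum>s'\<in>?N. ?w s' A * pmf (able_pmf G r) A)"
    by (rule sum.swap)
  \<comment> \<open>For a fixed able set the uniform weights sum to 1 if it contains a neighbor, and
    to 0 otherwise.\<close>
  also have "\<dots> = (\<Sum>A\<in>UNIV. indicator {A. A \<inter> ?N \<noteq> {}} A * pmf (able_pmf G r) A)"
  proof (intro sum.cong refl)
    fix A
    have "(\<Sum>s'\<in>?N. ?w s' A) = (\<Sum>s'\<in>A \<inter> ?N. 1 / real (card (A \<inter> ?N)))"
      by (intro sum.mono_neutral_cong_right) auto
    also have "\<dots> = indicator {A. A \<inter> ?N \<noteq> {}} A"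
      by (auto simp: indicator_def)
    finally show "(\<Sum>s'\<in>?N. ?w s' A * pmf (able_pmf G r) A)
        = indicator {A. A \<inter> ?N \<noteq> {}} A * pmf (able_pmf G r) A"
      by (simp only: sum_distrib_right[symmetric])
  qed
  also have "\<dots> = measure_pmf.expectation (able_pmf G r) (indicator {A. A \<inter> ?N \<noteq> {}})"
    by (subst integral_measure_pmf_real[of UNIV]) auto
  also have "\<dots> = measure_pmf.prob (able_pmf G r) (UNIV - {A. A \<inter> ?N = {}})"
    by (simp add: set_diff_eq)
  also have "\<dots> = 1 - (1 - able_prob G) ^ deg g r"
    using measure_pmf.prob_compl[of "{A. A \<inter> ?N = {}}" "able_pmf G r"]
    by (simp add: prob_no_neighbor_able[OF assms(1-3)])
  finally have *: "real (deg g r) * pmf (select_pmf G g r) (Some (r, s)) = \<dots>" .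
  have "deg g r > 0" using assms(4) by (auto simp: deg_def card_gt_0_iff)
  with * show ?thesis by (simp add: selection_prob_def field_simps)
qed

lemma pmf_meeting:
  fixes g :: "'p::finite network"
  assumes "network g" "0 < able_prob G" "able_prob G < 1"
    and "0 \<le> req_prob G" "real CARD('p) * req_prob G \<le> 1"
  shows "pmf (meeting_pmf G g) (Some (r, s)) =
    (if s \<in> nbrs g r then req_prob G * selection_prob G (deg g r) else 0)"
proof -
  have zero: "pmf (select_pmf G g r') (Some (r, s)) = 0" if "r' \<noteq> r \<or> s \<notin> nbrs g r'" for r'
    unfolding pmf_select by (rule sum.neutral) (use that in auto)
  let ?k = "\<lambda>z. case z of None \<Rightarrow> return_pmf None | Some r \<Rightarrow> select_pmf G g r"
  have "pmf (meeting_pmf G g) (Some (r, s)) =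
      (\<Sum>z\<in>UNIV. pmf (?k z) (Some (r, s)) * pmf (requester_pmf G) z)"
    unfolding meeting_pmf_select pmf_bind by (rule integral_measure_pmf_real) auto
  also have "\<dots> = (\<Sum>r'\<in>UNIV. pmf (select_pmf G g r') (Some (r, s)) * req_prob G)"
    by (simp add: UNIV_option_conv sum.reindex pmf_requester[OF assms(4,5)])
  also have "\<dots> = (\<Sum>r'\<in>UNIV. if r' = r then pmf (select_pmf G g r) (Some (r, s)) * req_prob G else 0)"
    by (intro sum.cong) (auto simp: zero)
  also have "\<dots> = pmf (select_pmf G g r) (Some (r, s)) * req_prob G"
    by simp
  finally show ?thesis
    using pmf_select_eq[OF assms(1-3), of s r] zero[of r] by auto
qed

lemma selection_prob_pos:
  "0 < able_prob G \<Longrightarrow> able_prob G < 1 \<Longrightarrow> 1 \<le> m \<Longrightarrow> 0 < selection_prob G m"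
  by (simp add: selection_prob_def power_less_one_iff)

section \<open>One-period payoffs when all favors are granted\<close>

definition all_coop :: "('p \<times> 'p) option \<Rightarrow> 'p interaction option" where
  "all_coop = map_option (\<lambda>(r, s). (r, s, Coop))"

definition coop_value :: "favor_params \<Rightarrow> 'p::finite network \<Rightarrow> 'p \<Rightarrow> real" where
  "coop_value G g i = measure_pmf.expectation (meeting_pmf G g) (\<lambda>z. payoff G i (all_coop z))"

text \<open>As requester, \<open>i\<close> receives \<open>v\<close> exactly when some neighbor is
  able. As provider to \<open>r\<close>, she is selected with a probability governed by the degree
  of \<open>r\<close>, not by her own.\<close>

lemma coop_value_eq:
  fixes g :: "'p::finite network"
  assumes "network g" "0 < able_prob G" "able_prob G < 1"
    and "0 \<le> req_prob G" "real CARD('p) * req_prob G \<le> 1"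
  shows "coop_value G g i = req_prob G * (benefit G * (1 - (1 - able_prob G) ^ deg g i)
           - cost G * (\<Sum>r\<in>nbrs g i. selection_prob G (deg g r)))"
proof -
  let ?q = "\<lambda>r. req_prob G * selection_prob G (deg g r)"
  have "coop_value G g i = (\<Sum>z\<in>UNIV. payoff G i (all_coop z) * pmf (meeting_pmf G g) z)"
    unfolding coop_value_def by (rule integral_measure_pmf_real) auto
  also have "\<dots> = (\<Sum>(r, s)\<in>UNIV. payoff G i (Some (r, s, Coop)) * (if s \<in> nbrs g r then ?q r else 0))"
    by (auto simp: UNIV_option_conv sum.reindex all_coop_def payoff_def[of _ _ None]
          pmf_meeting[OF assms] split_beta intro!: sum.cong)
  also have "\<dots> = (\<Sum>r\<in>UNIV. \<Sum>s\<in>UNIV.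
      payoff G i (Some (r, s, Coop)) * (if s \<in> nbrs g r then ?q r else 0))"
    by (simp add: UNIV_Times_UNIV[symmetric] sum.cartesian_product del: UNIV_Times_UNIV)
  \<comment> \<open>The roles of requester and provider separate because no player is her own
    neighbor, so \<open>r = s = i\<close> contributes nothing.\<close>
  also have "\<dots> = (\<Sum>r\<in>UNIV. \<Sum>s\<in>UNIV.
      (if r = i \<and> s \<in> nbrs g i then benefit G * ?q i else 0)
       + (if s = i \<and> r \<in> nbrs g i then - cost G * ?q r else 0))"
    using nbrs_irrefl[OF assms(1)]
    by (intro sum.cong refl) (auto simp: payoff_def nbrs_sym)
  also have "\<dots> = (\<Sum>r\<in>UNIV. \<Sum>s\<in>UNIV. if r = i \<and> s \<in> nbrs g i then benefit G * ?q i else 0)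
       + (\<Sum>s\<in>UNIV. \<Sum>r\<in>UNIV. if s = i \<and> r \<in> nbrs g i then - cost G * ?q r else 0)"
    unfolding sum.distrib by (rule arg_cong2[where f = "(+)", OF refl sum.swap])
  also have "\<dots> = (\<Sum>s\<in>nbrs g i. benefit G * ?q i) + (\<Sum>r\<in>nbrs g i. - cost G * ?q r)"
  proof -
    have "(\<Sum>y\<in>UNIV. \<Sum>x\<in>UNIV. if y = i \<and> x \<in> nbrs g i then f x else 0)
        = (\<Sum>x\<in>nbrs g i. f x)" for f :: "'p \<Rightarrow> real"
    proof -
      have "(\<Sum>y\<in>UNIV. \<Sum>x\<in>UNIV. if y = i \<and> x \<in> nbrs g i then f x else 0)
          = (\<Sum>y\<in>UNIV. if y = i then \<Sum>x\<in>UNIV. if x \<in> nbrs g i then f x else 0 else 0)"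
        by (intro sum.cong) auto
      also have "\<dots> = (\<Sum>x\<in>nbrs g i. f x)"
        by (simp add: sum.If_cases)
      finally show ?thesis .
    qed
    then show ?thesis by simp
  qed
  also have "\<dots> = req_prob G * (benefit G * (real (deg g i) * selection_prob G (deg g i))
      - cost G * (\<Sum>r\<in>nbrs g i. selection_prob G (deg g r)))"
    by (simp add: deg_def sum_negf sum_distrib_left algebra_simps)
  also have "real (deg g i) * selection_prob G (deg g i) = 1 - (1 - able_prob G) ^ deg g i"
    by (cases "deg g i = 0") (auto simp: selection_prob_def)
  finally show ?thesis .
qed

text \<open>The lost benefit is the increment of \<open>1 - (1 - p) ^ d\<close> at the last
  neighbor. Removing the link leaves the degrees of the other neighbors of \<open>i\<close>
  unchanged, so on the cost side only the term of \<open>j\<close> disappears.\<close>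

lemma coop_value_remove_link:
  fixes g :: "'p::finite network"
  assumes "network g" "0 < able_prob G" "able_prob G < 1"
    and "0 \<le> req_prob G" "real CARD('p) * req_prob G \<le> 1"
    and "{i, j} \<in> g"
  shows "coop_value G g i - coop_value G (g - {{i, j}}) i =
    req_prob G * (benefit G * (1 - able_prob G) ^ (deg g i - 1) * able_prob G
       - cost G * selection_prob G (deg g j))"
proof -
  let ?g' = "g - {{i, j}}"
  have net': "network ?g'" using assms(1) by (auto simp: network_def)
  have j: "j \<in> nbrs g i" using assms(6) by (simp add: nbrs_def)
  have nbrs_i: "nbrs ?g' i = nbrs g i - {j}"
    by (auto simp: nbrs_def doubleton_eq_iff)
  then have deg_i: "deg g i = Suc (deg ?g' i)"
    using card.remove[of "nbrs g i" j] j by (simp add: deg_def)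
  have "deg ?g' r = deg g r" if "r \<in> nbrs g i - {j}" for r
  proof -
    have "nbrs ?g' r = nbrs g r"
      using that nbrs_irrefl[OF assms(1), of i] by (auto simp: nbrs_def doubleton_eq_iff)
    then show ?thesis by (simp add: deg_def)
  qed
  then have "(\<Sum>r\<in>nbrs ?g' i. selection_prob G (deg ?g' r))
      = (\<Sum>r\<in>nbrs g i - {j}. selection_prob G (deg g r))"
    unfolding nbrs_i by (intro sum.cong) auto
  moreover have "(\<Sum>r\<in>nbrs g i. selection_prob G (deg g r)) =
      selection_prob G (deg g j) + (\<Sum>r\<in>nbrs g i - {j}. selection_prob G (deg g r))"
    by (rule sum.remove) (use j in auto)
  ultimately show ?thesis
    unfolding coop_value_eq[OF assms(1-5)] coop_value_eq[OF net' assms(2-5)]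
    by (simp add: deg_i algebra_simps)
qed

section \<open>Play and community histories\<close>

text \<open>\<open>L\<close> may stay random as long as the network it leads to is fixed. This
  matters after a refusal, when the decision of \<open>j\<close> about the link to \<open>i\<close>
  is not controlled.\<close>

lemma period_pmf_all_coop:
  assumes "\<And>L. L \<in> set_pmf (links_pmf \<Phi> g \<sigma> h) \<Longrightarrow> prune (net g h) L = g'"
    and "\<And>L r s. L \<in> set_pmf (links_pmf \<Phi> g \<sigma> h) \<Longrightarrow> Some (r, s) \<in> set_pmf (meeting_pmf G g') \<Longrightarrow>
      favor_pmf \<Phi> g \<sigma> h L r s = return_pmf Coop"
  shows "period_pmf G \<Phi> g \<sigma> h =
    bind_pmf (links_pmf \<Phi> g \<sigma> h) (\<lambda>L. map_pmf (\<lambda>z. (L, all_coop z)) (meeting_pmf G g'))"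
  unfolding period_pmf_def
proof (rule bind_pmf_cong[OF refl])
  fix L assume L: "L \<in> set_pmf (links_pmf \<Phi> g \<sigma> h)"
  show "bind_pmf (meeting_pmf G (prune (net g h) L)) (\<lambda>z. case z of
       None \<Rightarrow> return_pmf (L, None)
     | Some (r, s) \<Rightarrow> map_pmf (\<lambda>a. (L, Some (r, s, a))) (favor_pmf \<Phi> g \<sigma> h L r s))
    = map_pmf (\<lambda>z. (L, all_coop z)) (meeting_pmf G g')"
    unfolding assms(1)[OF L] map_pmf_def[of "\<lambda>z. (L, all_coop z)"]
    by (rule bind_pmf_cong[OF refl]) (auto simp: all_coop_def assms(2)[OF L] split: option.splits)
qed

lemma map_snd_period_pmf:
  assumes "period_pmf G \<Phi> g \<sigma> h = bind_pmf M (\<lambda>L. map_pmf (\<lambda>z. (L, f z)) N)"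
  shows "map_pmf snd (period_pmf G \<Phi> g \<sigma> h) = map_pmf f N"
  by (simp add: assms map_bind_pmf map_pmf_comp)

text \<open>Whatever history is reached after \<open>h\<close>, the next interaction has the same
  law. All expectations in the discounted sum therefore coincide and the series is
  geometric.\<close>

lemma cont_value_all_coop:
  assumes "0 < discount G" "discount G < 1"
    and "\<And>k h'. h' \<in> set_pmf (play G \<Phi> g \<sigma> h k) \<Longrightarrow>
      map_pmf snd (period_pmf G \<Phi> g \<sigma> h') = map_pmf all_coop (meeting_pmf G g')"
  shows "cont_value G \<Phi> g \<sigma> i h = coop_value G g' i / (1 - discount G)"
proof -
  have "measure_pmf.expectation (play G \<Phi> g \<sigma> h (Suc k)) (\<lambda>h'. payoff G i (snd (last h')))
      = coop_value G g' i" for k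
  proof -
    have "map_pmf (\<lambda>h'. snd (last h')) (play G \<Phi> g \<sigma> h (Suc k))
        = bind_pmf (play G \<Phi> g \<sigma> h k) (\<lambda>h'. map_pmf snd (period_pmf G \<Phi> g \<sigma> h'))"
      by (simp add: map_bind_pmf map_pmf_comp)
    also have "\<dots> = bind_pmf (play G \<Phi> g \<sigma> h k) (\<lambda>_. map_pmf all_coop (meeting_pmf G g'))"
      by (rule bind_pmf_cong[OF refl]) (rule assms(3))
    finally have last: "map_pmf (\<lambda>h'. snd (last h')) (play G \<Phi> g \<sigma> h (Suc k))
        = map_pmf all_coop (meeting_pmf G g')"
      by simp
    have "measure_pmf.expectation (play G \<Phi> g \<sigma> h (Suc k)) (\<lambda>h'. payoff G i (snd (last h')))
        = measure_pmf.expectation (map_pmf (\<lambda>h'. snd (last h')) (play G \<Phi> g \<sigma> h (Suc k))) (payoff G i)"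
      by (rule integral_map_pmf[symmetric])
    also have "\<dots> = coop_value G g' i"
      unfolding last coop_value_def by simp
    finally show ?thesis .
  qed
  then show ?thesis
    unfolding cont_value_def using assms(1,2)
    by (simp add: suminf_mult2[symmetric] summable_geometric suminf_geometric divide_simps)
qed

lemma play_SucI:
  "h' \<in> set_pmf (play G \<Phi> g \<sigma> h k) \<Longrightarrow> x \<in> set_pmf (period_pmf G \<Phi> g \<sigma> h')
    \<Longrightarrow> h' @ [x] \<in> set_pmf (play G \<Phi> g \<sigma> h (Suc k))"
  by auto

lemma play_SucE:
  assumes "h1 \<in> set_pmf (play G \<Phi> g \<sigma> h (Suc k))"
  obtains h' x where "h1 = h' @ [x]" "h' \<in> set_pmf (play G \<Phi> g \<sigma> h k)"
    "x \<in> set_pmf (period_pmf G \<Phi> g \<sigma> h')"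
  using assms by auto

lemma length_play: "h' \<in> set_pmf (play G \<Phi> g \<sigma> h k) \<Longrightarrow> length h' = length h + k"
  by (induction k arbitrary: h') auto

lemma play_append:
  assumes "h \<in> set_pmf (play G \<Phi> g \<sigma> h0 m)"
  shows "h' \<in> set_pmf (play G \<Phi> g \<sigma> h k) \<Longrightarrow> h' \<in> set_pmf (play G \<Phi> g \<sigma> h0 (m + k))"
  using assms by (induction k arbitrary: h') auto

text \<open>\<open>nodes\<close> asks for reachability under some profile, so histories reached by
  the deviation also count, and measurability constrains \<open>\<sigma>\<close> there.\<close>

lemma Link_node_in_nodes:
  "h \<in> set_pmf (play G \<Phi> g \<sigma> [] k) \<Longrightarrow> Link_node h \<in> nodes G \<Phi> g"
  using length_play[of h G \<Phi> g \<sigma> "[]" k]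
  by (auto simp: nodes_def pmf_positive_iff intro!: exI[of _ \<sigma>])

lemma Favor_node_in_nodes:
  assumes "h \<in> set_pmf (play G \<Phi> g \<sigma> [] k)" "L \<in> set_pmf (links_pmf \<Phi> g \<sigma> h)"
    and "Some (r, s) \<in> set_pmf (meeting_pmf G (prune (net g h) L))"
  shows "Favor_node h L r s \<in> nodes G \<Phi> g"
  unfolding nodes_def using assms length_play[OF assms(1)]
  by (auto intro!: exI[of _ \<sigma>] mult_pos_pos simp: pmf_positive_iff)

lemma links_pmf_component:
  fixes g :: "'p::finite network"
  assumes "b \<in> nbrs (net g h) a"
  shows "map_pmf (\<lambda>L. L (a, b)) (links_pmf \<Phi> g \<sigma> h) = link_choice (\<sigma> a) (priv \<Phi> g a h) b"
  unfolding links_pmf_def by (subst Pi_pmf_component) (use assms in auto)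

lemma prune_Keep [simp]: "prune g (\<lambda>_. Keep) = g"
  by (auto simp: prune_def)

lemma net_append [simp]: "net g (h @ [x]) = prune (net g h) (fst x)"
  by (simp add: net_def)

lemma net_Nil [simp]: "net g [] = g"
  by (simp add: net_def)

lemma comm_hist_append [simp]:
  "comm_hist \<Phi> a b (h @ [x]) = comm_hist \<Phi> a b h @ [restrict_opt (pair_relevant \<Phi> a b) (snd x)]"
  by (simp add: comm_hist_def)

lemma community_in: "partition_on UNIV \<Phi> \<Longrightarrow> community \<Phi> a \<in> \<Phi> \<and> a \<in> community \<Phi> a"
  unfolding community_def
  by (rule theI') (auto simp: partition_on_def disjoint_def)

lemma community_eq: "partition_on UNIV \<Phi> \<Longrightarrow> k \<in> community \<Phi> a \<Longrightarrow> community \<Phi> k = community \<Phi> a"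
  using community_in[of \<Phi> k] community_in[of \<Phi> a]
  by (auto simp: partition_on_def disjoint_def)

text \<open>If \<open>a\<close> and \<open>b\<close> share a community, the interactions relevant to
  them stay inside it; otherwise only their own are relevant. A refusal across communities is thus
  invisible to every other relationship.\<close>

lemma pair_relevant_across:
  assumes "partition_on UNIV \<Phi>" "community \<Phi> r \<noteq> community \<Phi> s"
    and "pair_relevant \<Phi> a b (r, s, x)"
  shows "{a, b} = {r, s}"
proof (cases "community \<Phi> a = community \<Phi> b")
  case True
  then obtain k where "k \<in> community \<Phi> a" "{r, s} \<subseteq> {a, b, k}"
    using assms(3) by (auto simp: pair_relevant_def)
  then have "community \<Phi> r = community \<Phi> s"
    using True community_eq[OF assms(1), of k a] by auto
  with assms(2) show ?thesis by simp
next
  case False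
  then show ?thesis using assms(3) by (simp add: pair_relevant_def)
qed

section \<open>The equilibrium path\<close>

locale cooperative_profile =
  fixes G :: favor_params
    and \<Phi> :: "'p::finite set set"
    and g :: "'p network"
    and \<sigma> :: "'p profile"
  assumes req: "0 < req_prob G" "real CARD('p) * req_prob G \<le> 1"
    and able: "0 < able_prob G" "able_prob G < 1"
    and disc: "0 < discount G" "discount G < 1"
    and part: "partition_on UNIV \<Phi>"
    and net: "network g"
    and measurable: "community_measurable G \<Phi> g \<sigma>"
    and coop: "cooperative_path G \<Phi> g \<sigma>"
begin

text \<open>Since \<open>\<alpha> > 0\<close> and \<open>0 < p < 1\<close>, each link meets with
  positive probability in both roles.\<close>

lemma Some_in_meeting:
  fixes g' :: "'p network"
  assumes "network g'"
  shows "Some (r, s) \<in> set_pmf (meeting_pmf G g') \<longleftrightarrow> {r, s} \<in> g'"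
proof -
  have "0 < selection_prob G (deg g' r)" if "s \<in> nbrs g' r"
  proof (rule selection_prob_pos[OF able])
    show "1 \<le> deg g' r" using that by (auto simp: deg_def Suc_le_eq card_gt_0_iff)
  qed
  then show ?thesis
    using pmf_meeting[OF assms able less_imp_le[OF req(1)] req(2), of r s] req(1)
    by (auto simp: set_pmf_iff nbrs_def)
qed

text \<open>The witness is a request with nobody able, possible as \<open>p < 1\<close>. The
  requester law itself may give \<open>None\<close> mass 0, namely when \<open>\<alpha>\<close>
  times the number of players is 1.\<close>

lemma None_in_meeting: "None \<in> set_pmf (meeting_pmf G g' :: ('p \<times> 'p) option pmf)"
proof -
  obtain r :: 'p where "r \<in> UNIV" by blast
  have "Some r \<in> set_pmf (requester_pmf G)"
    using req by (simp add: set_pmf_iff pmf_requester)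
  moreover have "(\<lambda>_. False) \<in> set_pmf (Pi_pmf (UNIV - {r}) False (\<lambda>_. bernoulli_pmf (able_prob G)))"
    using able by (auto simp: set_Pi_pmf PiE_dflt_def set_pmf_bernoulli)
  then have "{} \<in> set_pmf (able_pmf G r)"
    by (force simp: able_pmf_def)
  ultimately show ?thesis
    unfolding meeting_pmf_def by (force simp: set_bind_pmf)
qed

lemma on_path_last:
  assumes "h @ [(L, z)] \<in> set_pmf (play G \<Phi> g \<sigma> [] t)"
  shows "L = (\<lambda>_. Keep)" and "z = Some (r, s, a) \<Longrightarrow> a = Coop"
proof -
  have *: "(\<forall>i j. L (i, j) = Keep) \<and> (\<forall>r s a. z = Some (r, s, a) \<longrightarrow> a = Coop)"
    using bspec[OF bspec[OF spec[OF coop[unfolded cooperative_path_def]] assms], of "(L, z)"] by simp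
  show "L = (\<lambda>_. Keep)" using * by auto
  show "z = Some (r, s, a) \<Longrightarrow> a = Coop" using * by blast
qed

text \<open>\<open>cooperative_path\<close> speaks of realized histories only. Any link profile in
  the support can be completed by a period without interaction to such a history, so it must be
  constantly \<open>Keep\<close>.\<close>

lemma on_path_links:
  assumes "h \<in> set_pmf (play G \<Phi> g \<sigma> [] t)"
  shows "links_pmf \<Phi> g \<sigma> h = return_pmf (\<lambda>_. Keep)"
proof -
  have "L = (\<lambda>_. Keep)" if L: "L \<in> set_pmf (links_pmf \<Phi> g \<sigma> h)" for L
  proof -
    have "(L, None) \<in> set_pmf (period_pmf G \<Phi> g \<sigma> h)"
      unfolding period_pmf_def set_bind_pmf using L None_in_meeting by (force split: option.split)
    then have "h @ [(L, None)] \<in> set_pmf (play G \<Phi> g \<sigma> [] (Suc t))"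
      by (rule play_SucI[OF assms])
    then show ?thesis by (rule on_path_last)
  qed
  then show ?thesis
    by (intro set_pmf_subset_singleton[THEN iffD1]) auto
qed

lemma on_path_net: "h \<in> set_pmf (play G \<Phi> g \<sigma> [] t) \<Longrightarrow> net g h = g"
proof (induction t arbitrary: h)
  case (Suc t)
  obtain h' x where h: "h = h' @ [x]" "h' \<in> set_pmf (play G \<Phi> g \<sigma> [] t)"
    using Suc.prems by (rule play_SucE)
  have "fst x = (\<lambda>_. Keep)"
    using on_path_last(1)[of h' "fst x" "snd x"] Suc.prems h(1) by (metis prod.collapse)
  then show ?case using Suc.IH[OF h(2)] h(1) by simp
qed simp

text \<open>The same passage from realized histories to strategies: linked players meet with
  positive probability, so every answer in the support is realized.\<close>

lemma on_path_favor:
  assumes "h \<in> set_pmf (play G \<Phi> g \<sigma> [] t)" "{r, s} \<in> g"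
  shows "favor_pmf \<Phi> g \<sigma> h (\<lambda>_. Keep) r s = return_pmf Coop"
proof -
  have "a = Coop" if a: "a \<in> set_pmf (favor_pmf \<Phi> g \<sigma> h (\<lambda>_. Keep) r s)" for a
  proof -
    have "(\<lambda>_. Keep, Some (r, s, a)) \<in> set_pmf (period_pmf G \<Phi> g \<sigma> h)"
      using a Some_in_meeting[OF net] assms(2)
      by (auto simp: period_pmf_def on_path_links[OF assms(1)] on_path_net[OF assms(1)] bind_return_pmf
          intro!: bexI[of _ "Some (r, s)"])
    then have "h @ [(\<lambda>_. Keep, Some (r, s, a))] \<in> set_pmf (play G \<Phi> g \<sigma> [] (Suc t))"
      by (rule play_SucI[OF assms(1)])
    then show ?thesis by (rule on_path_last(2)) simp
  qed
  then show ?thesis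
    by (intro set_pmf_subset_singleton[THEN iffD1]) auto
qed

lemma on_path_period:
  assumes "h \<in> set_pmf (play G \<Phi> g \<sigma> [] t)"
  shows "period_pmf G \<Phi> g \<sigma> h =
    bind_pmf (links_pmf \<Phi> g \<sigma> h) (\<lambda>L. map_pmf (\<lambda>z. (L, all_coop z)) (meeting_pmf G g))"
  by (rule period_pmf_all_coop)
    (use assms in \<open>auto simp: on_path_links on_path_net on_path_favor Some_in_meeting net\<close>)

lemma on_path_extend:
  assumes "h \<in> set_pmf (play G \<Phi> g \<sigma> [] t)" "z \<in> set_pmf (meeting_pmf G g)"
  shows "h @ [(\<lambda>_. Keep, all_coop z)] \<in> set_pmf (play G \<Phi> g \<sigma> [] (Suc t))"
  using assms by (intro play_SucI) (auto simp: on_path_period on_path_links bind_return_pmf)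

lemma on_path_value:
  assumes "h \<in> set_pmf (play G \<Phi> g \<sigma> [] t)"
  shows "cont_value G \<Phi> g \<sigma> i h = coop_value G g i / (1 - discount G)"
  by (rule cont_value_all_coop[OF disc], rule map_snd_period_pmf,
      rule on_path_period, rule play_append[OF assms])

lemma on_path_link_choice:
  assumes "h \<in> set_pmf (play G \<Phi> g \<sigma> [] t)" "{a, b} \<in> g"
  shows "link_choice (\<sigma> a) (priv \<Phi> g a h) b = return_pmf Keep"
  using links_pmf_component[of b g h a \<Phi> \<sigma>] assms
  by (simp add: on_path_net on_path_links nbrs_def)

end

section \<open>Breaking off a link across communities\<close>

text \<open>In the first period the deviator still keeps the link to \<open>j\<close>, so that the histories after the
  refusal are reached by the deviation profile itself and hence belong to the game tree.\<close>

definition break_off :: "'p \<Rightarrow> 'p strategy" where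
  "break_off j = \<lparr>
     link_choice = (\<lambda>q k. return_pmf (if k = j \<and> fst q \<noteq> [] then Remove else Keep)),
     favor_choice = (\<lambda>q l k. return_pmf (if k = j then Defect else Coop))\<rparr>"

locale cross_link = cooperative_profile G \<Phi> g \<sigma>
  for G :: favor_params and \<Phi> :: "'p::finite set set" and g :: "'p network" and \<sigma> :: "'p profile" +
  fixes i j :: 'p
  assumes link: "{i, j} \<in> g"
    and across: "community \<Phi> i \<noteq> community \<Phi> j"
begin

abbreviation dev :: "'p profile" where "dev \<equiv> \<sigma>(i := break_off j)"
abbreviation g' :: "'p network" where "g' \<equiv> g - {{i, j}}"

abbreviation refusal :: "'p history" where "refusal \<equiv> [(\<lambda>_. Keep, Some (j, i, Defect))]"

lemma net': "network g'"
  using net by (auto simp: network_def)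

text \<open>At the empty history \<open>break_off\<close> keeps all links, as
  \<open>\<sigma>\<close> does, so the first link stage is unchanged. Then \<open>j\<close> asks
  \<open>i\<close> with positive probability and \<open>i\<close> refuses.\<close>

lemma refusal_reached: "refusal \<in> set_pmf (play G \<Phi> g dev [] 1)"
proof -
  have "links_pmf \<Phi> g dev [] = links_pmf \<Phi> g \<sigma> []"
    unfolding links_pmf_def
    using on_path_link_choice[of "[]" 0]
    by (intro Pi_pmf_cong) (auto simp: break_off_def priv_def nbrs_def)
  also have "\<dots> = return_pmf (\<lambda>_. Keep)"
    by (rule on_path_links[of _ 0]) simp
  finally have "links_pmf \<Phi> g dev [] = return_pmf (\<lambda>_. Keep)" .
  moreover have "Some (j, i) \<in> set_pmf (meeting_pmf G g)"
    using Some_in_meeting[OF net] link by (simp add: insert_commute)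
  ultimately have "(\<lambda>_. Keep, Some (j, i, Defect)) \<in> set_pmf (period_pmf G \<Phi> g dev [])"
    by (force simp: period_pmf_def bind_return_pmf favor_pmf_def break_off_def
        intro!: bexI[of _ "Some (j, i)"])
  then show ?thesis by simp
qed

text \<open>At two such histories in the game tree, measurability makes \<open>\<sigma>\<close> act
  alike in every relationship other than \<open>{i, j}\<close>, even if private histories
  differ.\<close>

definition indistinguishable :: "'p history \<Rightarrow> 'p history \<Rightarrow> bool" where
  "indistinguishable h h' \<longleftrightarrow>
     (\<forall>a b. a \<noteq> b \<and> {a, b} \<noteq> {i, j} \<longrightarrow> comm_hist \<Phi> a b h = comm_hist \<Phi> a b h')"

lemma indistinguishable_refusal:
  "indistinguishable refusal [(\<lambda>_. Keep, Some (j, i, Coop))]"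
  using pair_relevant_across[OF part, of j i] across
  by (auto simp: indistinguishable_def comm_hist_def restrict_opt_def insert_commute)

text \<open>Measurability transfers behavior at \<open>h\<close> from the equilibrium-path history
  \<open>h'\<close>, while \<open>break_off\<close> fixes the behavior of \<open>i\<close>. The
  condition on \<open>net g h\<close> covers both the time right after the refusal, when the link is
  still present, and later periods, when it is gone.\<close>

lemma dev_period:
  assumes h: "h \<in> set_pmf (play G \<Phi> g dev [] t)" "t \<noteq> 0"
    and h': "h' \<in> set_pmf (play G \<Phi> g \<sigma> [] t)"
    and ind: "indistinguishable h h'"
    and net_h: "net g h - {{i, j}} = g'"
  shows "L \<in> set_pmf (links_pmf \<Phi> g dev h) \<Longrightarrow> prune (net g h) L = g'"
    and "period_pmf G \<Phi> g dev h =
      bind_pmf (links_pmf \<Phi> g dev h) (\<lambda>L. map_pmf (\<lambda>z. (L, all_coop z)) (meeting_pmf G g'))"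
proof -
  have "h \<noteq> []" using length_play[OF h(1)] h(2) by auto
  then have priv_h: "fst (priv \<Phi> g i h) \<noteq> []" by (simp add: priv_def)
  have net_h_irrefl: "a \<noteq> b" if "{a, b} \<in> net g h" for a b
  proof
    assume "a = b"
    moreover have "i \<noteq> j" using across by auto
    ultimately have "{a, b} \<noteq> {i, j}" by auto
    then have "{a, b} \<in> g'" using that net_h by blast
    then show False using link_distinct[OF net'] \<open>a = b\<close> by blast
  qed
  have keep: "link_choice (dev a) (priv \<Phi> g a h) b = return_pmf Keep"
    if ab: "{a, b} \<in> net g h" "{a, b} \<noteq> {i, j}" for a b
  proof (cases "a = i")
    case True
    with ab show ?thesis by (auto simp: break_off_def)
  next
    case False
    have "link_choice (\<sigma> a) (priv \<Phi> g a h) b = link_choice (\<sigma> a) (priv \<Phi> g a h') b"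
      using measurable ind ab net_h_irrefl[OF ab(1)]
        Link_node_in_nodes[OF h(1)] Link_node_in_nodes[OF h']
      unfolding community_measurable_def indistinguishable_def by blast
    also have "\<dots> = return_pmf Keep"
      using on_path_link_choice[OF h', of a b] ab net_h by blast
    finally show ?thesis using False by simp
  qed
  show links: "prune (net g h) L = g'" if L: "L \<in> set_pmf (links_pmf \<Phi> g dev h)" for L
  proof -
    have L_in: "L (a, b) \<in> set_pmf (link_choice (dev a) (priv \<Phi> g a h) b)"
      if "{a, b} \<in> net g h" for a b
      using L links_pmf_component[of b g h a \<Phi> dev, symmetric] that by (auto simp: nbrs_def)
    have "L (a, b) = Keep" if "{a, b} \<in> net g h" "{a, b} \<noteq> {i, j}" for a b
      using L_in[OF that(1)] keep[OF that] by simp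
    \<comment> \<open>Removal by \<open>i\<close> alone deletes the link, whatever \<open>j\<close>
      decides. Here the past is nonempty, which is when \<open>break_off\<close> removes.\<close>
    moreover have "L (i, j) = Remove" if "{i, j} \<in> net g h"
      using L_in[OF that] priv_h by (simp add: break_off_def)
    ultimately have "prune (net g h) L = net g h - {{i, j}}"
      unfolding prune_def by fastforce
    then show ?thesis using net_h by simp
  qed
  have "favor_pmf \<Phi> g dev h L r s = return_pmf Coop"
    if L: "L \<in> set_pmf (links_pmf \<Phi> g dev h)" and rs: "Some (r, s) \<in> set_pmf (meeting_pmf G g')"
    for L r s
  proof (cases "s = i")
    case True
    then have "r \<noteq> j" using rs Some_in_meeting[OF net'] by (auto simp: insert_commute)
    with True show ?thesis by (simp add: favor_pmf_def break_off_def)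
  next
    case False
    have in_g': "{r, s} \<in> g'" using rs Some_in_meeting[OF net'] by simp
    have "Favor_node h L r s \<in> nodes G \<Phi> g"
      by (rule Favor_node_in_nodes[OF h(1) L]) (simp add: links[OF L] rs)
    moreover have "Favor_node h' (\<lambda>_. Keep) r s \<in> nodes G \<Phi> g"
      by (rule Favor_node_in_nodes[OF h'])
        (use in_g' in \<open>simp_all add: on_path_links[OF h'] on_path_net[OF h'] Some_in_meeting net\<close>)
    moreover have "s \<noteq> r" using link_distinct[OF net' in_g'] by simp
    moreover have "comm_hist \<Phi> s r h = comm_hist \<Phi> s r h'"
      using ind in_g' \<open>s \<noteq> r\<close> by (auto simp: indistinguishable_def insert_commute)
    \<comment> \<open>Measurability of favor choices ranges over all link profiles, so
      \<open>L\<close> may differ from the constant \<open>Keep\<close> used at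
      \<open>h'\<close>.\<close>
    ultimately have "favor_pmf \<Phi> g \<sigma> h L r s = favor_pmf \<Phi> g \<sigma> h' (\<lambda>_. Keep) r s"
      using measurable unfolding community_measurable_def by blast
    also have "\<dots> = return_pmf Coop"
      by (rule on_path_favor[OF h']) (use in_g' in simp)
    finally show ?thesis using False by (simp add: favor_pmf_def)
  qed
  with links show "period_pmf G \<Phi> g dev h =
      bind_pmf (links_pmf \<Phi> g dev h) (\<lambda>L. map_pmf (\<lambda>z. (L, all_coop z)) (meeting_pmf G g'))"
    by (rule period_pmf_all_coop)
qed

lemma dev_path:
  assumes "h \<in> set_pmf (play G \<Phi> g dev refusal k)"
  shows "h \<in> set_pmf (play G \<Phi> g dev [] (Suc k))"
  using play_append[OF refusal_reached assms] by simp

text \<open>Each history after the refusal is paired with an equilibrium-path history in which that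
  favor was granted and the same meetings followed. Both histories are extended by the same
  interaction, so indistinguishability persists.\<close>

lemma dev_shadow:
  assumes "h \<in> set_pmf (play G \<Phi> g dev refusal k)"
  shows "net g h - {{i, j}} = g' \<and>
    (\<exists>h'\<in>set_pmf (play G \<Phi> g \<sigma> [] (Suc k)). indistinguishable h h')"
  using assms
proof (induction k arbitrary: h)
  case 0
  have "[] @ [(\<lambda>_. Keep, all_coop (Some (j, i)))] \<in> set_pmf (play G \<Phi> g \<sigma> [] (Suc 0))"
    by (rule on_path_extend) (use link in \<open>simp_all add: Some_in_meeting net insert_commute\<close>)
  then have "\<exists>h'\<in>set_pmf (play G \<Phi> g \<sigma> [] (Suc 0)). indistinguishable refusal h'"
    using indistinguishable_refusal by (auto simp: all_coop_def)
  with 0 show ?case by (simp add: net_def)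
next
  case (Suc k)
  obtain h0 x where h: "h = h0 @ [x]" and h0: "h0 \<in> set_pmf (play G \<Phi> g dev refusal k)"
    and x: "x \<in> set_pmf (period_pmf G \<Phi> g dev h0)"
    using Suc.prems by (rule play_SucE)
  obtain h' where net_h0: "net g h0 - {{i, j}} = g'"
    and h': "h' \<in> set_pmf (play G \<Phi> g \<sigma> [] (Suc k))" "indistinguishable h0 h'"
    using Suc.IH[OF h0] by blast
  note period = dev_period[OF dev_path[OF h0] _ h' net_h0]
  obtain L z where x_eq: "x = (L, all_coop z)" and L: "L \<in> set_pmf (links_pmf \<Phi> g dev h0)"
    and z: "z \<in> set_pmf (meeting_pmf G g')"
    using x by (auto simp: period(2))
  \<comment> \<open>A meeting possible on \<open>g'\<close> is possible on the larger network
    \<open>g\<close>, so the shadow history stays on the path.\<close>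
  have "z \<in> set_pmf (meeting_pmf G g)"
    using z None_in_meeting by (cases z) (auto simp: Some_in_meeting net net')
  then have "h' @ [(\<lambda>_. Keep, all_coop z)] \<in> set_pmf (play G \<Phi> g \<sigma> [] (Suc (Suc k)))"
    by (rule on_path_extend[OF h'(1)])
  moreover have "indistinguishable h (h' @ [(\<lambda>_. Keep, all_coop z)])"
    using h'(2) by (simp add: indistinguishable_def h x_eq)
  moreover have "net g h = g'"
    using period(1)[OF _ L] by (simp add: h x_eq)
  ultimately show ?case by auto
qed

lemma dev_value: "cont_value G \<Phi> g dev k refusal = coop_value G g' k / (1 - discount G)"
proof (rule cont_value_all_coop[OF disc], rule map_snd_period_pmf)
  fix n h assume h: "h \<in> set_pmf (play G \<Phi> g dev refusal n)"
  then obtain h' where "net g h - {{i, j}} = g'"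
    and "h' \<in> set_pmf (play G \<Phi> g \<sigma> [] (Suc n))" "indistinguishable h h'"
    using dev_shadow by blast
  then show "period_pmf G \<Phi> g dev h =
      bind_pmf (links_pmf \<Phi> g dev h) (\<lambda>L. map_pmf (\<lambda>z. (L, all_coop z)) (meeting_pmf G g'))"
    using dev_period(2)[OF dev_path[OF h]] by blast
qed

section \<open>Beliefs and incentives at the request made by \<open>j\<close>\<close>

abbreviation refusal_node :: "'p node" where
  "refusal_node \<equiv> Favor_node [] (\<lambda>_. Keep) j i"

lemma refusal_node_in_info_set:
  "refusal_node \<in> info_set G \<Phi> g i (info_at \<Phi> g i refusal_node)"
proof -
  have "refusal_node \<in> nodes G \<Phi> g"
    by (rule Favor_node_in_nodes[of _ _ _ _ \<sigma> 0])
      (use link in \<open>simp_all add: on_path_links[of _ 0] Some_in_meeting net insert_commute\<close>)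
  then show ?thesis by (simp add: info_set_def)
qed

text \<open>The information set also contains nodes where links of other players have just been removed;
  these have probability zero under \<open>\<sigma>\<close>, and the information set itself has positive probability, so
  consistency excludes them.\<close>

lemma refusal_belief:
  assumes "consistent G \<Phi> g \<sigma> \<mu>"
  shows "\<mu> i (info_at \<Phi> g i refusal_node) = return_pmf refusal_node"
proof -
  let ?I = "info_at \<Phi> g i refusal_node"
  let ?S = "info_set G \<Phi> g i ?I"
  obtain \<Sigma> where lim: "profile_tendsto \<Sigma> \<sigma>"
    and bayes: "\<And>x. x \<in> ?S \<Longrightarrow> (\<lambda>n. bayes G \<Phi> g (\<Sigma> n) i ?I x) \<longlonglongrightarrow> pmf (\<mu> i ?I) x"
    using assms unfolding consistent_def by blast
  \<comment> \<open>Equal private histories have equal length, and the information fixes provider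
    and requester, so nodes can differ only in the link profile.\<close>
  have S: "\<exists>L. x = Favor_node [] L j i" if "x \<in> ?S" for x
    using that by (cases x) (auto simp: info_set_def priv_def)
  have links: "(\<lambda>n. pmf (links_pmf \<Phi> g (\<Sigma> n) []) L) \<longlonglongrightarrow> pmf (links_pmf \<Phi> g \<sigma> []) L" for L
  proof (cases "\<forall>x. x \<notin> {(a, b). b \<in> nbrs (net g []) a} \<longrightarrow> L x = Keep")
    case True
    then show ?thesis
      using lim unfolding links_pmf_def profile_tendsto_def pmf_Pi[OF finite] if_P[OF True] split_beta
      by (intro tendsto_prod) blast
  next
    case False
    then show ?thesis unfolding links_pmf_def pmf_Pi[OF finite] by (simp only: if_False tendsto_const)
  qed
  have prob: "(\<lambda>n. node_prob G \<Phi> g (\<Sigma> n) x) \<longlonglongrightarrow> node_prob G \<Phi> g \<sigma> x" if x: "x \<in> ?S" for x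
  proof -
    obtain L where "x = Favor_node [] L j i" using S[OF x] by blast
    then show ?thesis using links[of L] by (auto intro!: tendsto_intros)
  qed
  have on_path: "links_pmf \<Phi> g \<sigma> [] = return_pmf (\<lambda>_. Keep)"
    by (rule on_path_links[of _ 0]) simp
  have pos: "node_prob G \<Phi> g \<sigma> refusal_node > 0"
    using link Some_in_meeting[OF net, of j i]
    by (simp add: on_path pmf_positive_iff insert_commute)
  have "node_prob G \<Phi> g \<sigma> x = 0" if "x \<in> ?S - {refusal_node}" for x
    using S[of x] that by (auto simp: on_path indicator_def split: if_splits)
  \<comment> \<open>Only \<open>refusal_node\<close> has positive mass in the limit, so the
    denominator of Bayes' rule tends to a positive number and the quotient to 1.\<close>
  then have total: "(\<Sum>y\<in>?S. node_prob G \<Phi> g \<sigma> y) = node_prob G \<Phi> g \<sigma> refusal_node"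
    using refusal_node_in_info_set
    by (subst sum.remove[OF finite_info_set refusal_node_in_info_set]) simp
  have "(\<lambda>n. \<Sum>y\<in>?S. node_prob G \<Phi> g (\<Sigma> n) y) \<longlonglongrightarrow> node_prob G \<Phi> g \<sigma> refusal_node"
    unfolding total[symmetric] by (intro tendsto_sum prob)
  then have "(\<lambda>n. bayes G \<Phi> g (\<Sigma> n) i ?I refusal_node) \<longlonglongrightarrow>
      node_prob G \<Phi> g \<sigma> refusal_node / node_prob G \<Phi> g \<sigma> refusal_node"
    unfolding bayes_def by (rule tendsto_divide[OF prob[OF refusal_node_in_info_set]]) (use pos in linarith)
  with bayes[OF refusal_node_in_info_set]
  have "pmf (\<mu> i ?I) refusal_node = node_prob G \<Phi> g \<sigma> refusal_node / node_prob G \<Phi> g \<sigma> refusal_node"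
    by (rule LIMSEQ_unique)
  also have "\<dots> = 1"
    by (rule divide_self) (use pos in linarith)
  finally have "measure_pmf.prob (\<mu> i ?I) {refusal_node} = 1"
    by (simp add: measure_pmf_single)
  then have "set_pmf (\<mu> i ?I) \<subseteq> {refusal_node}"
    using measure_pmf.prob_eq_1[of "{refusal_node}" "\<mu> i ?I"] by (auto simp: AE_measure_pmf_iff)
  then show ?thesis
    by (simp add: set_pmf_subset_singleton)
qed

text \<open>Refusing saves \<open>c - \<gamma>\<close> today and loses the one-period value of the
  link in every later period, which is worth \<open>\<delta> / (1 - \<delta>)\<close> times that
  value today. As the belief is degenerate, rationality compares exactly these amounts.\<close>

lemma sequential_equilibrium_bound:
  assumes "sequential_equilibrium G \<Phi> g \<sigma> \<mu>"
  shows "discount G * req_prob G * (benefit G * (1 - able_prob G) ^ (deg g i - 1) * able_prob G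
      - cost G * selection_prob G (deg g j)) \<ge> (1 - discount G) * (cost G - refusal_cost G)"
proof -
  let ?I = "info_at \<Phi> g i refusal_node"
  have "i \<noteq> j" using across by auto
  have nonempty: "info_set G \<Phi> g i ?I \<noteq> {}"
    using refusal_node_in_info_set by blast
  have "node_value G \<Phi> g dev i refusal_node \<le> node_value G \<Phi> g \<sigma> i refusal_node"
  proof -
    have "\<mu> i ?I = return_pmf refusal_node"
      using assms refusal_belief unfolding sequential_equilibrium_def by blast
    moreover have "measure_pmf.expectation (\<mu> i ?I) (node_value G \<Phi> g dev i)
        \<le> measure_pmf.expectation (\<mu> i ?I) (node_value G \<Phi> g \<sigma> i)"
      using assms nonempty unfolding sequential_equilibrium_def sequentially_rational_def by blast
    ultimately show ?thesis by simp
  qed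
  moreover have "node_value G \<Phi> g dev i refusal_node
      = - refusal_cost G + discount G * (coop_value G g' i / (1 - discount G))"
    by (simp add: favor_pmf_def break_off_def payoff_def dev_value[unfolded break_off_def])
  moreover have "node_value G \<Phi> g \<sigma> i refusal_node
      = - cost G + discount G * (coop_value G g i / (1 - discount G))"
  proof -
    have "[] @ [(\<lambda>_. Keep, all_coop (Some (j, i)))] \<in> set_pmf (play G \<Phi> g \<sigma> [] (Suc 0))"
      by (rule on_path_extend) (use link in \<open>simp_all add: Some_in_meeting net insert_commute\<close>)
    from on_path_value[OF this, of i]
    have "cont_value G \<Phi> g \<sigma> i [(\<lambda>_. Keep, Some (j, i, Coop))] =
        coop_value G g i / (1 - discount G)"
      by (simp add: all_coop_def)
    moreover have "favor_pmf \<Phi> g \<sigma> [] (\<lambda>_. Keep) j i = return_pmf Coop"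
      by (rule on_path_favor[of _ 0]) (use link in \<open>simp_all add: insert_commute\<close>)
    ultimately show ?thesis using \<open>i \<noteq> j\<close> by (simp add: payoff_def)
  qed
  ultimately have "cost G - refusal_cost G \<le>
      discount G * (coop_value G g i - coop_value G g' i) / (1 - discount G)"
    by (simp add: right_diff_distrib diff_divide_distrib)
  then have "(1 - discount G) * (cost G - refusal_cost G) \<le>
      discount G * (coop_value G g i - coop_value G g' i)"
    using disc by (simp add: pos_le_divide_eq mult.commute)
  also have "coop_value G g i - coop_value G g' i = req_prob G *
      (benefit G * (1 - able_prob G) ^ (deg g i - 1) * able_prob G
       - cost G * selection_prob G (deg g j))"
    using req by (intro coop_value_remove_link[OF net able _ _ link]) auto
  finally show ?thesis by (simp add: mult.assoc)
qed

text \<open>Replacing \<open>selection_prob G (deg g j)\<close> by the no larger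
  \<open>selection_prob G (deg g i)\<close> can only lower the cost term, so the bound with mixed
  degrees yields the inequality at \<open>deg g i\<close>.\<close>

lemma cooperation_ineq_of_equilibrium:
  assumes "sequential_equilibrium G \<Phi> g \<sigma> \<mu>" "deg g j \<le> deg g i" "0 < cost G"
  shows "cooperation_ineq G (deg g i)"
proof -
  have "i \<in> nbrs g j" using link by (simp add: nbrs_def insert_commute)
  then have "1 \<le> deg g j"
    by (auto simp: deg_def Suc_le_eq card_gt_0_iff)
  then have "selection_prob G (deg g i) \<le> selection_prob G (deg g j)"
    using selection_prob_antimono[OF able _ assms(2)] by simp
  then have "discount G * req_prob G * cost G * selection_prob G (deg g i)
      \<le> discount G * req_prob G * cost G * selection_prob G (deg g j)"
    using disc req assms(3) by (intro mult_left_mono) auto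
  then show ?thesis
    using sequential_equilibrium_bound[OF assms(1)]
    by (simp add: cooperation_ineq_def selection_prob_def[symmetric] algebra_simps)
qed

end

theorem proposition7:
  fixes G :: favor_params
    and \<Phi> :: "'p::finite set set"
    and g :: "'p network"
    and B :: nat
  assumes "0 < req_prob G" "req_prob G \<le> 1"
    and "real CARD('p) * req_prob G \<le> 1"
    and "0 < able_prob G" "able_prob G < 1"
    and "0 < discount G" "discount G < 1"
    and "0 < cost G" "cost G < benefit G"
    and "0 \<le> refusal_cost G" "refusal_cost G < cost G"
    and "cooperation_bound G B"
    and "partition_on UNIV \<Phi>"
    and "network g"
    and "community_stable G \<Phi> g"
  shows "(\<forall>i. card (community \<Phi> i) \<le> B \<longrightarrow> deg g i \<le> B) \<and>
         (\<forall>i. deg g i > B \<longrightarrow>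
            card (community \<Phi> i) > B \<and> (\<forall>j. {i, j} \<in> g \<longrightarrow> j \<in> community \<Phi> i))"
proof -
  obtain \<sigma> \<mu> where profile: "cooperative_profile G \<Phi> g \<sigma>"
    and eq: "sequential_equilibrium G \<Phi> g \<sigma> \<mu>"
    using assms unfolding community_stable_def community_equilibrium_def cooperative_profile_def
    by blast
  have bounded: "deg g i \<le> B"
    if "{i, j} \<in> g" "community \<Phi> i \<noteq> community \<Phi> j" "deg g j \<le> deg g i" for i j
  proof -
    interpret cross_link G \<Phi> g \<sigma> i j
      by (intro cross_link.intro cross_link_axioms.intro profile that)
    have "cooperation_ineq G (deg g i)"
      by (rule cooperation_ineq_of_equilibrium[OF eq that(3) \<open>0 < cost G\<close>])
    then show ?thesis
      using \<open>cooperation_bound G B\<close> unfolding cooperation_bound_def by (meson not_le)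
  qed
  have same: "j \<in> community \<Phi> i" if "deg g i > B" "{i, j} \<in> g" for i j
  proof (rule ccontr)
    assume "j \<notin> community \<Phi> i"
    then have "community \<Phi> i \<noteq> community \<Phi> j"
      using community_in[OF \<open>partition_on UNIV \<Phi>\<close>, of j] by auto
    \<comment> \<open>If \<open>j\<close> has the smaller or equal degree, \<open>bounded\<close>
      applies to \<open>i\<close>; otherwise it bounds the larger degree of \<open>j\<close>. Either
      way \<open>deg g i \<le> B\<close>.\<close>
    then show False
      using bounded[of i j] bounded[of j i] that by (force simp: insert_commute)
  qed
  have large: "card (community \<Phi> i) > B" if "deg g i > B" for i
  proof -
    have "nbrs g i \<subseteq> community \<Phi> i"
      using same[OF that] by (auto simp: nbrs_def)
    then have "deg g i \<le> card (community \<Phi> i)"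
      unfolding deg_def by (rule card_mono[OF finite])
    with that show ?thesis by simp
  qed
  \<comment> \<open>The first claim is the contrapositive of \<open>large\<close>.\<close>
  show ?thesis
    using same large by (meson not_le)
qed

end
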